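(* Let $\lambda$ be a nonzero real number. For all integers $n,l\ge0$, \[ S_{1,\lambda}(n,l)=\sum_{k=l}^{n}S_{J,\lambda}^{(1)}(n,k)\,S_{2,\lambda}(k,l). \]
   Context: For a nonzero real $\lambda$, let $e_\lambda(t)=(1+\lambda t)^{1/\lambda}$ and $\log_\lambda(1+t)=\frac{1}{\lambda}((1+t)^\lambda-1)$ (its compositional inverse). The degenerate Stirling numbers are defined by $\frac{1}{k!}(\log_\lambda(1+t))^k=\sum_{n\ge k}S_{1,\lambda}(n,k)\frac{t^n}{n!}$ and $\frac{1}{k!}(e_\lambda(t)-1)^k=\sum_{n\ge k}S_{2,\lambda}(n,k)\frac{t^n}{n!}$, and the Jindalrae-Stirling numbers of the first kind by $\frac{1}{k!}\big(\log_\lambda(\log_\lambda(1+t)+1)\big)^k=\sum_{n\ge k}S_{J,\lambda}^{(1)}(n,k)\frac{t^n}{n!}$ (for $k\ge0$). These numbers are taken to be $0$ when the first index is smaller than the second, and an empty sum is $0$. *)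

theory Defs
  imports "HOL-Computational_Algebra.Formal_Power_Series"
begin

(* Generating functions are formal power series over the reals; fps_binomial a is the
   binomial series of (1 + t)^a. *)

definition deg_exp :: "real \<Rightarrow> real fps" where
  "deg_exp lam = fps_binomial (1 / lam) oo (fps_const lam * fps_X)"

(* The series of log_lam(1 + t) in t, so log_lam(1 + f) is deg_log lam oo f. *)
definition deg_log :: "real \<Rightarrow> real fps" where
  "deg_log lam = fps_const (1 / lam) * (fps_binomial lam - 1)"

definition deg_stirling1 :: "real \<Rightarrow> nat \<Rightarrow> nat \<Rightarrow> real" where
  "deg_stirling1 lam n k = fact n * fps_nth (fps_const (1 / fact k) * deg_log lam ^ k) n"

definition deg_stirling2 :: "real \<Rightarrow> nat \<Rightarrow> nat \<Rightarrow> real" where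
  "deg_stirling2 lam n k = fact n * fps_nth (fps_const (1 / fact k) * (deg_exp lam - 1) ^ k) n"

definition jindalrae_stirling1 :: "real \<Rightarrow> nat \<Rightarrow> nat \<Rightarrow> real" where
  "jindalrae_stirling1 lam n k =
     fact n * fps_nth (fps_const (1 / fact k) * (deg_log lam oo deg_log lam) ^ k) n"

lemma deg_exp_nth_0: "fps_nth (deg_exp lam) 0 = 1"
  by (simp add: deg_exp_def)

lemma deg_log_nth_0: "fps_nth (deg_log lam) 0 = 0"
  by (simp add: deg_log_def)

(* The generating functions have zero constant term, so the convention that the numbers
   vanish for n < k holds automatically. *)

lemma deg_stirling1_eq_0: "n < k \<Longrightarrow> deg_stirling1 lam n k = 0"
  by (simp add: deg_stirling1_def deg_log_nth_0 startsby_zero_power_prefix)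

lemma deg_stirling2_eq_0: "n < k \<Longrightarrow> deg_stirling2 lam n k = 0"
  by (simp add: deg_stirling2_def deg_exp_nth_0 startsby_zero_power_prefix)

lemma jindalrae_stirling1_eq_0: "n < k \<Longrightarrow> jindalrae_stirling1 lam n k = 0"
  by (simp add: jindalrae_stirling1_def deg_log_nth_0 startsby_zero_power_prefix)

end

theory Submission
  imports Defs
begin

text \<open>
  Composition of binomial series multiplies exponents, because both sides solve the differential
  equation characterising the binomial series. Hence \<open>e\<^sub>\<lambda>(t) - 1\<close> is a left compositional inverse
  of \<open>log\<^sub>\<lambda>(1 + t)\<close>, and composing \<open>(e\<^sub>\<lambda>(t) - 1)\<^sup>l / l!\<close> with the twofold iterate of
  \<open>log\<^sub>\<lambda>(1 + t)\<close> leaves \<open>log\<^sub>\<lambda>(1 + t)\<^sup>l / l!\<close>; the theorem compares coefficients.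
\<close>

text \<open>Clearing the denominator \<open>1 + fps_X\<close> leaves only products and sums, over
  which composition distributes.\<close>

lemma one_plus_X_mult_deriv_fps_binomial:
  "(1 + fps_X) * fps_deriv (fps_binomial c) = fps_const (c :: 'a :: field_char_0) * fps_binomial c"
  unfolding fps_binomial_deriv by (simp add: fps_divide_unit ac_simps inverse_mult_eq_1')

lemma fps_binomial_compose_fps_binomial:
  fixes a b :: "'a :: field_char_0"
  shows "fps_binomial b oo (fps_binomial a - 1) = fps_binomial (a * b)"
proof -
  let ?A = "fps_binomial a" and ?B = "fps_binomial b"
  let ?F = "?B oo (?A - 1)"
  have A0: "fps_nth (?A - 1) 0 = 0"
    by simp
  have A_nz: "?A \<noteq> 0"
    by (metis fps_binomial_nth fps_zero_nth gbinomial_0(1) zero_neq_one)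
  have "((1 + fps_X) * fps_deriv ?B) oo (?A - 1) = (fps_const b * ?B) oo (?A - 1)"
    by (simp only: one_plus_X_mult_deriv_fps_binomial)
  then have B: "?A * (fps_deriv ?B oo (?A - 1)) = fps_const b * ?F"
    by (simp add: fps_compose_mult_distrib[OF A0] fps_compose_add_distrib)
  \<comment> \<open>The extra factor \<open>?A\<close> is what \<open>1 + fps_X\<close> becomes
    under composition with \<open>?A - 1\<close>; it is cancelled at the end.\<close>
  have "?A * ((1 + fps_X) * fps_deriv ?F) =
      (?A * (fps_deriv ?B oo (?A - 1))) * ((1 + fps_X) * fps_deriv ?A)"
    by (simp add: fps_compose_deriv[OF A0] ac_simps)
  also have "\<dots> = ?A * (fps_const (a * b) * ?F)"
    unfolding B one_plus_X_mult_deriv_fps_binomial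
    by (simp add: ac_simps flip: fps_const_mult)
  finally have ode: "(1 + fps_X) * fps_deriv ?F = fps_const (a * b) * ?F"
    using A_nz by simp
  have "fps_deriv ?F = fps_const (a * b) * ?F / (1 + fps_X)"
    by (subst ode[symmetric]) (simp add: fps_divide_unit ac_simps inverse_mult_eq_1')
  \<comment> \<open>Constant term 1 singles out the solution.\<close>
  then show ?thesis
    by (subst fps_binomial_ODE_unique'[symmetric]) simp
qed

text \<open>The scalings \<open>lam\<close> and \<open>1 / lam\<close> cancel, leaving binomial
  series whose exponents multiply to 1.\<close>

lemma deg_exp_compose_deg_log:
  assumes "lam \<noteq> 0"
  shows "(deg_exp lam - 1) oo deg_log lam = fps_X"
proof -
  have "deg_exp lam oo deg_log lam =
      fps_binomial (1 / lam) oo ((fps_const lam * fps_X) oo deg_log lam)"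
    unfolding deg_exp_def by (rule fps_compose_assoc[symmetric]) (simp_all add: deg_log_nth_0)
  also have "(fps_const lam * fps_X) oo deg_log lam = fps_const lam * deg_log lam"
    by (simp add: fps_compose_mult_distrib deg_log_nth_0)
  also have "\<dots> = fps_binomial lam - 1"
    using assms by (simp add: deg_log_def flip: mult.assoc)
  also have "fps_binomial (1 / lam) oo (fps_binomial lam - 1) = 1 + fps_X"
    using assms by (simp add: fps_binomial_compose_fps_binomial fps_binomial_1)
  finally show ?thesis
    by (simp add: fps_compose_sub_distrib)
qed

theorem theorem7:
  fixes lam :: real and n l :: nat
  assumes "lam \<noteq> 0"
  shows "deg_stirling1 lam n l =
    (\<Sum>k = l..n. jindalrae_stirling1 lam n k * deg_stirling2 lam k l)"
proof -
  let ?L = "deg_log lam" and ?E = "deg_exp lam - 1"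
  have "?E oo (?L oo ?L) = ?L"
    using assms by (simp add: fps_compose_assoc deg_log_nth_0 deg_exp_compose_deg_log)
  then have "?L ^ l = ?E ^ l oo (?L oo ?L)"
    by (metis deg_log_nth_0 fps_compose_nth_0 fps_compose_power)
  \<comment> \<open>In the coefficient of the composition, \<open>fact k\<close> from
    \<open>deg_stirling2\<close> cancels \<open>1 / fact k\<close> from
    \<open>jindalrae_stirling1\<close>.\<close>
  then have "deg_stirling1 lam n l =
      (\<Sum>k = 0..n. jindalrae_stirling1 lam n k * deg_stirling2 lam k l)"
    by (simp add: deg_stirling1_def deg_stirling2_def jindalrae_stirling1_def
        fps_compose_nth sum_distrib_left ac_simps)
  also have "\<dots> = (\<Sum>k = l..n. jindalrae_stirling1 lam n k * deg_stirling2 lam k l)"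
    by (rule sum.mono_neutral_right) (auto simp: deg_stirling2_eq_0)
  finally show ?thesis .
qed

end
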